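(* Let $d\leqslant a$, and for $\kappa=(k_1,\dots,k_n)\in J_d$ let $\sigma_\kappa=\prod_{i=1}^n\mu_i^{(k_i)}$. Then $$\rho_n^{\mathrm{polynomial},d}=\inf\Big\{\sum_{\kappa\in J_d}q_\kappa\sigma_\kappa\ :\ (q_\kappa)_{\kappa\in J_d}\in\mathbb{R}^{|J_d|},\ \ \mathbf{1}_{x\in S}\leqslant\sum_{\kappa\in J_d}q_\kappa\bar{x}^\kappa\ \ \forall x\in\mathcal{X}^n\Big\}.$$
   Context: Let $\mathcal{X}\subset\mathbb{R}$ and $\mathcal{P}(\mathcal{X})$ be the set of probability distributions on $\mathcal{X}$. Let $n,a,d\geqslant 1$ be integers. For $i=1,\dots,n$ and $k=1,\dots,a$ let $\mu_i^{(k)}\in\mathbb{R}$ be prescribed moments, realized by at least one distribution on $\mathcal{X}$ for each $i$, and set $\mu_i^{(0)}=1$. Let $J_d=\{(k_1,\dots,k_n)\in\mathbb{N}^n : k_1+\dots+k_n\leqslant d\}$ (with $0\in\mathbb{N}$), and for $\kappa\in J_d$ let $\bar{x}^\kappa=\prod_{i=1}^n x_i^{k_i}$. Let $\mathcal{Q}_d^n=\{Q(x)=\sum_{\kappa\in J_d}q_\kappa\bar{x}^\kappa : q_\kappa\in\mathbb{R}\}$. Let $S\subset\mathcal{X}^n$ be a set of the form $S=\{x\in\mathbb{R}^n : h_1(x)\geqslant 0,\dots,h_r(x)\geqslant 0\}$ with polynomials $h_j$, such that there exists a polynomial $s=s_0+\sum_{j=1}^r s_jh_j$, with $s_0,\dots,s_r$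 sums of squares of polynomials, for which $\{x\in\mathbb{R}^n : s(x)\geqslant 0\}$ is compact. Define $$\rho_n^{\mathrm{polynomial},d}=\inf_{Q\in\mathcal{Q}_d^n,\ \mathbf{1}_{x\in S}\leqslant Q(x)\ \forall x\in\mathcal{X}^n}\ \ \sup_{p_1,\dots,p_n}\ \int_{\mathcal{X}}\cdots\int_{\mathcal{X}}Q(x_1,\dots,x_n)\,dp_1(x_1)\cdots dp_n(x_n),$$ where the supremum is over $p_i\in\mathcal{P}(\mathcal{X})$ with $\int_{\mathcal{X}}x_i^k\,dp_i(x_i)=\mu_i^{(k)}$ for all $i$ and all $k=1,\dots,a$. *)

theory Defs
  imports "HOL-Probability.Probability"
begin

text \<open>The dimension n is the cardinality of the finite index type 'n. Infima and suprema are taken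
  in the extended reals.\<close>

definition cube :: "real set \<Rightarrow> (real ^ 'n) set" where
  "cube X = {x. \<forall>i. x $ i \<in> X}"

definition multi_indices :: "nat \<Rightarrow> ('n::finite \<Rightarrow> nat) set" where
  "multi_indices d = {\<kappa>. (\<Sum>i\<in>UNIV. \<kappa> i) \<le> d}"

lemma finite_multi_indices: "finite (multi_indices d :: ('n::finite \<Rightarrow> nat) set)"
proof (rule finite_subset)
  show "multi_indices d \<subseteq> (PiE UNIV (\<lambda>_. {..d}) :: ('n \<Rightarrow> nat) set)"
  proof
    fix \<kappa> :: "'n \<Rightarrow> nat"
    assume "\<kappa> \<in> multi_indices d"
    then have "(\<Sum>i\<in>UNIV. \<kappa> i) \<le> d"
      by (simp add: multi_indices_def)
    moreover have "\<kappa> i \<le> (\<Sum>i\<in>UNIV. \<kappa> i)" for i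
      by (rule member_le_sum) auto
    ultimately show "\<kappa> \<in> PiE UNIV (\<lambda>_. {..d})"
      by (auto intro: order_trans)
  qed
  show "finite (PiE UNIV (\<lambda>_. {..d}) :: ('n \<Rightarrow> nat) set)"
    by (rule finite_PiE) auto
qed

definition monomial :: "('n::finite \<Rightarrow> nat) \<Rightarrow> real ^ 'n \<Rightarrow> real" where
  "monomial \<kappa> x = (\<Prod>i\<in>UNIV. (x $ i) ^ \<kappa> i)"

text \<open>Only the values of q on \<open>multi_indices d\<close> matter.\<close>

definition poly_of_coeffs :: "nat \<Rightarrow> (('n::finite \<Rightarrow> nat) \<Rightarrow> real) \<Rightarrow> real ^ 'n \<Rightarrow> real" where
  "poly_of_coeffs d q x = (\<Sum>\<kappa>\<in>multi_indices d. q \<kappa> * monomial \<kappa> x)"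

definition polys :: "nat \<Rightarrow> (real ^ 'n::finite \<Rightarrow> real) set" where
  "polys d = range (poly_of_coeffs d)"

definition sum_of_squares :: "(real ^ 'n::finite \<Rightarrow> real) \<Rightarrow> bool" where
  "sum_of_squares f \<longleftrightarrow>
     (\<exists>(m::nat) g. (\<forall>i<m. real_polynomial_function (g i)) \<and> f = (\<lambda>x. \<Sum>i<m. (g i x)\<^sup>2))"

definition compactness_certificate :: "nat \<Rightarrow> (nat \<Rightarrow> real ^ 'n::finite \<Rightarrow> real) \<Rightarrow> bool" where
  "compactness_certificate r h \<longleftrightarrow>
     (\<exists>s. (\<forall>j\<in>{0..r}. sum_of_squares (s j)) \<and>
          compact {x. s 0 x + (\<Sum>j=1..r. s j x * h j x) \<ge> 0})"

text \<open>Distributions on X are probability measures on the Borel sets of the subspace X, so no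
  measurability of X is needed. The predicate \<open>has_bochner_integral\<close> includes integrability: the
  prescribed moments have to exist.\<close>

definition moment_distributions :: "real set \<Rightarrow> nat \<Rightarrow> (nat \<Rightarrow> real) \<Rightarrow> real measure set" where
  "moment_distributions X a m =
     {p. prob_space p \<and> sets p = sets (restrict_space borel X) \<and>
         (\<forall>k\<in>{1..a}. has_bochner_integral p (\<lambda>x. x ^ k) (m k))}"

text \<open>The n-fold integral is the integral with respect to the product measure. When \<open>d \<le> a\<close>, every
  monomial of degree at most d is integrable for it, so it agrees with the iterated integral.\<close>

definition rho_polynomial ::
  "real set \<Rightarrow> (real ^ 'n::finite) set \<Rightarrow> nat \<Rightarrow> ('n \<Rightarrow> nat \<Rightarrow> real) \<Rightarrow> nat \<Rightarrow> ereal" where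
  "rho_polynomial X S a \<mu> d =
     (INF Q \<in> {Q \<in> polys d. \<forall>x\<in>cube X. indicator S x \<le> Q x}.
      SUP p \<in> {p. \<forall>i. p i \<in> moment_distributions X a (\<mu> i)}.
        ereal (\<integral>x. Q (\<chi> i. x i) \<partial>(\<Pi>\<^sub>M i\<in>UNIV. p i)))"

definition moment_product :: "('n::finite \<Rightarrow> nat \<Rightarrow> real) \<Rightarrow> ('n \<Rightarrow> nat) \<Rightarrow> real" where
  "moment_product \<mu> \<kappa> = (\<Prod>i\<in>UNIV. \<mu> i (\<kappa> i))"

end

theory Submission
  imports Defs
begin

text \<open>Since \<open>d \<le> a\<close>, every monomial of degree at most d involves only prescribed moments, and by
  independence its expectation is a product of them. So the inner supremum is taken over a constant
  function on a nonempty set.\<close>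

text \<open>Exponent 0 is not among the constraints of \<open>moment_distributions\<close>; there
  the integral is the total mass 1, which agrees with the convention \<open>m 0 = 1\<close>. Thus
  coordinates absent from a monomial need no separate treatment later.\<close>

lemma has_bochner_integral_power_moment_distributions:
  assumes p: "p \<in> moment_distributions X a m" and "m 0 = 1" and "k \<le> a"
  shows "has_bochner_integral p (\<lambda>x. x ^ k) (m k)"
proof (cases "k = 0")
  case True
  interpret prob_space p
    using p by (simp add: moment_distributions_def)
  show ?thesis
    using True \<open>m 0 = 1\<close> by (simp add: has_bochner_integral_iff prob_space)
next
  case False
  then show ?thesis
    using p \<open>k \<le> a\<close> by (simp add: moment_distributions_def)
qed

text \<open>A monomial is a product of functions of one coordinate each, so its integral against the
  product measure factors by Fubini. Stating this with \<open>has_bochner_integral\<close> keeps the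
  integrability that linearity requires afterwards.\<close>

lemma has_bochner_integral_monomial:
  fixes \<mu> :: "'n::finite \<Rightarrow> nat \<Rightarrow> real"
  assumes p: "\<And>i. p i \<in> moment_distributions X a (\<mu> i)"
    and \<mu>: "\<And>i. \<mu> i 0 = 1"
    and \<kappa>: "\<kappa> \<in> multi_indices a"
  shows "has_bochner_integral (\<Pi>\<^sub>M i\<in>UNIV. p i) (\<lambda>x. monomial \<kappa> (\<chi> i. x i)) (moment_product \<mu> \<kappa>)"
proof -
  have "prob_space (p i)" for i
    using p[of i] by (simp add: moment_distributions_def)
  then interpret product_prob_space p UNIV
    by (simp add: product_prob_spaceI)
  \<comment> \<open>Exponents are natural numbers, so each one is bounded by the total
    degree.\<close>
  have "\<kappa> i \<le> a" for i
    using \<kappa> member_le_sum[of i UNIV \<kappa>] by (auto simp: multi_indices_def)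
  then have "has_bochner_integral (p i) (\<lambda>x. x ^ \<kappa> i) (\<mu> i (\<kappa> i))" for i
    using has_bochner_integral_power_moment_distributions p \<mu> by blast
  then have int: "integrable (p i) (\<lambda>x. x ^ \<kappa> i)" and eq: "(\<integral>x. x ^ \<kappa> i \<partial>p i) = \<mu> i (\<kappa> i)" for i
    by (simp_all add: has_bochner_integral_iff)
  show ?thesis
    using product_integrable_prod[of UNIV "\<lambda>i x. x ^ \<kappa> i"]
      product_integral_prod[of UNIV "\<lambda>i x. x ^ \<kappa> i"]
    by (simp add: has_bochner_integral_iff monomial_def moment_product_def int eq)
qed

text \<open>Linearity over the finitely many monomials. The point is that \<open>p\<close> has
  disappeared from the right-hand side.\<close>

lemma integral_poly_of_coeffs:
  fixes \<mu> :: "'n::finite \<Rightarrow> nat \<Rightarrow> real"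
  assumes p: "\<And>i. p i \<in> moment_distributions X a (\<mu> i)"
    and \<mu>: "\<And>i. \<mu> i 0 = 1"
    and "d \<le> a"
  shows "(\<integral>x. poly_of_coeffs d q (\<chi> i. x i) \<partial>(\<Pi>\<^sub>M i\<in>UNIV. p i)) =
    (\<Sum>\<kappa>\<in>multi_indices d. q \<kappa> * moment_product \<mu> \<kappa>)"
  unfolding poly_of_coeffs_def
proof (intro has_bochner_integral_integral_eq has_bochner_integral_sum
    has_bochner_integral_mult_right)
  fix \<kappa> :: "'n \<Rightarrow> nat"
  assume "\<kappa> \<in> multi_indices d"
  then have "\<kappa> \<in> multi_indices a"
    using \<open>d \<le> a\<close> by (auto simp: multi_indices_def)
  then show "has_bochner_integral (\<Pi>\<^sub>M i\<in>UNIV. p i) (\<lambda>x. monomial \<kappa> (\<chi> i. x i)) (moment_product \<mu> \<kappa>)"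
    by (rule has_bochner_integral_monomial[OF p \<mu>])
qed

theorem proposition12:
  fixes X :: "real set"
    and S :: "(real ^ 'n::finite) set"
    and h :: "nat \<Rightarrow> real ^ 'n \<Rightarrow> real"
    and \<mu> :: "'n \<Rightarrow> nat \<Rightarrow> real"
    and a d r :: nat
  assumes "a \<ge> 1" and "d \<ge> 1"
    and "\<And>i. \<mu> i 0 = 1"
    and "\<And>i. moment_distributions X a (\<mu> i) \<noteq> {}"
    and "\<And>j. j \<in> {1..r} \<Longrightarrow> real_polynomial_function (h j)"
    and "S = {x. \<forall>j\<in>{1..r}. h j x \<ge> 0}"
    and "S \<subseteq> cube X"
    and "compactness_certificate r h"
    and "d \<le> a"
  shows "rho_polynomial X S a \<mu> d =
    Inf {ereal (\<Sum>\<kappa>\<in>multi_indices d. q \<kappa> * moment_product \<mu> \<kappa>) | q.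
           \<forall>x\<in>cube X. indicator S x \<le> (\<Sum>\<kappa>\<in>multi_indices d. q \<kappa> * monomial \<kappa> x)}"
proof -
  let ?P = "{p. \<forall>i. p i \<in> moment_distributions X a (\<mu> i)}"
  \<comment> \<open>One distribution is chosen for each coordinate. Over an empty set the supremum
    in the extended reals would be minus infinity instead of the constant value.\<close>
  have nonempty: "?P \<noteq> {}"
    using choice[of "\<lambda>i p. p \<in> moment_distributions X a (\<mu> i)"] assms(4) by blast
  have sup: "(SUP p\<in>?P. ereal (\<integral>x. poly_of_coeffs d q (\<chi> i. x i) \<partial>(\<Pi>\<^sub>M i\<in>UNIV. p i))) =
      ereal (\<Sum>\<kappa>\<in>multi_indices d. q \<kappa> * moment_product \<mu> \<kappa>)" for q
    using nonempty by (intro SUP_eq_const) (auto intro: integral_poly_of_coeffs assms(3,9))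
  \<comment> \<open>The infimum is moved from polynomials to coefficient families. Several
    \<open>q\<close> can give the same polynomial, but an infimum over an image is insensitive to
    such repetitions.\<close>
  have feasible: "{Q \<in> polys d. \<forall>x\<in>cube X. indicator S x \<le> Q x} =
      poly_of_coeffs d ` {q. \<forall>x\<in>cube X. indicator S x \<le> poly_of_coeffs d q x}"
    by (auto simp: polys_def)
  show ?thesis
    unfolding rho_polynomial_def feasible image_image sup
    by (simp add: poly_of_coeffs_def setcompr_eq_image)
qed

end
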